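(* If $n > 3$ is an integer, then \[ \sum_{d=1}^{n} \mu(d)\, 2^{\lfloor n/d\rfloor - \lfloor (n-3)/d\rfloor} = \begin{cases} 3 + M(n), & \text{if } n \text{ is even},\\ 4 + M(n), & \text{if } n \text{ is odd}.\end{cases} \]
   Context: $\mu$ is the Möbius function, $\lfloor x\rfloor$ is the floor of $x$, and $M(n) = \sum_{d=1}^n \mu(d)$ is the Mertens function. *)

theory Defs
  imports "HOL-Number_Theory.Number_Theory" "HOL-Computational_Algebra.Squarefree"
begin

definition moebius_mu :: "nat \<Rightarrow> int" where
  "moebius_mu n = (if squarefree n then (-1) ^ card (prime_factors n) else 0)"

definition mertens :: "nat \<Rightarrow> int" where
  "mertens n = (\<Sum>d=1..n. moebius_mu d)"

end

theory Submission
  imports Defs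
begin

text \<open>
  The exponent \<open>n div d - (n - 3) div d\<close> counts the multiples of \<open>d\<close> among \<open>n - 2, n - 1, n\<close>.
  Call it \<open>k\<close>. Then \<open>2 ^ k = 1 + k\<close> whenever \<open>k \<le> 1\<close>, which fails only for \<open>d = 1\<close> (excess 4)
  and, when \<open>n\<close> is even, for \<open>d = 2\<close> (excess 1, with sign \<open>-1\<close>). The terms \<open>1\<close> add up to the
  Mertens function, and the terms \<open>k\<close> contribute the divisor sums of the Moebius function
  at \<open>n - 2, n - 1, n > 1\<close>, all of which vanish.
\<close>

text \<open>Since \<open>p\<close> is coprime to \<open>d\<close>, the factor \<open>p\<close>
  leaves squarefreeness unchanged and adds exactly one new prime factor, which flips the
  sign.\<close>

lemma moebius_mu_prime_mult:
  assumes "prime p" "\<not> p dvd d"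
  shows "moebius_mu (p * d) = - moebius_mu d"
proof -
  have d0: "d \<noteq> 0" using assms by (metis dvd_0_right)
  have cop: "coprime p d" using assms by (simp add: prime_imp_coprime)
  have "squarefree (p * d) \<longleftrightarrow> squarefree d"
    using assms cop by (auto intro: squarefree_mult_coprime squarefree_prime dest: squarefree_multD)
  moreover have "prime_factors (p * d) = insert p (prime_factors d)"
    using assms d0 by (simp add: prime_factors_product prime_prime_factors prime_gt_0_nat)
  moreover have "p \<notin> prime_factors d" using assms(2) by auto
  ultimately show ?thesis by (simp add: moebius_mu_def)
qed

text \<open>Fix a prime \<open>p\<close> dividing \<open>m\<close>. Multiplication by
  \<open>p\<close> matches the squarefree divisors not divisible by \<open>p\<close> with those
  divisible by \<open>p\<close>, and matched terms cancel.\<close>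

lemma sum_moebius_mu_divisors:
  assumes "m > (1::nat)"
  shows "(\<Sum>d | d dvd m. moebius_mu d) = 0"
proof -
  obtain p where p: "prime p" "p dvd m" using assms prime_factor_nat by (metis less_irrefl)
  let ?A = "{d. d dvd m \<and> squarefree d \<and> \<not> p dvd d}"
  let ?B = "{d. d dvd m \<and> squarefree d \<and> p dvd d}"
  have fin: "finite {d. d dvd m}" using assms by (intro finite_divisors_nat) simp
  have finA: "finite ?A" and finB: "finite ?B" by (rule finite_subset[OF _ fin]; auto)+
  have "(\<Sum>d | d dvd m. moebius_mu d) = (\<Sum>d\<in>?A \<union> ?B. moebius_mu d)"
    using fin by (intro sum.mono_neutral_right) (auto simp: moebius_mu_def)
  also have "\<dots> = (\<Sum>d\<in>?A. moebius_mu d) + (\<Sum>d\<in>?B. moebius_mu d)"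
    using finA finB by (intro sum.union_disjoint) auto
  also have "(\<Sum>d\<in>?B. moebius_mu d) = (\<Sum>d\<in>?A. moebius_mu (p * d))"
  proof (rule sum.reindex_bij_witness[where i = "\<lambda>d. p * d" and j = "\<lambda>d. d div p"])
    fix d assume "d \<in> ?B"
    then obtain e where e: "d = p * e" "d dvd m" "squarefree d" by (auto elim: dvdE)
    have "\<not> p dvd e"
    proof
      assume "p dvd e"
      then have "p\<^sup>2 dvd d" using e(1) by (simp add: power2_eq_square)
      then have "p dvd 1" using e(3) by (auto simp: squarefree_def)
      then show False using p(1) by simp
    qed
    then show "d div p \<in> ?A"
      using e p(1) by (auto dest: squarefree_multD dvd_mult_right simp: prime_gt_0_nat)
  next
    fix d assume d: "d \<in> ?A"
    then have cop: "coprime p d" using p(1) by (simp add: prime_imp_coprime)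
    then show "p * d \<in> ?B"
      using d p by (auto intro: divides_mult squarefree_mult_coprime squarefree_prime)
  qed (use p(1) in \<open>auto simp: prime_gt_0_nat\<close>)
  also have "\<dots> = (\<Sum>d\<in>?A. - moebius_mu d)"
    using p(1) by (intro sum.cong) (auto simp: moebius_mu_prime_mult)
  finally show ?thesis by (simp add: sum_negf)
qed

text \<open>Puts the divisor sums of different \<open>m\<close> over the same range as the Mertens
  sum, so that they can be added termwise.\<close>

lemma sum_moebius_mu_dvd_indicator:
  assumes "1 < m" "m \<le> n"
  shows "(\<Sum>d=1..n. moebius_mu d * of_bool (d dvd m)) = 0"
proof -
  have "(\<Sum>d=1..n. moebius_mu d * of_bool (d dvd m)) = (\<Sum>d | d dvd m. moebius_mu d)"
  proof (rule sum.mono_neutral_cong_right)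
    have "0 < d \<and> d \<le> n" if "d dvd m" for d
      using that assms dvd_imp_le[of d m] dvd_pos_nat[of m d] by linarith
    then show "{d. d dvd m} \<subseteq> {1..n}" by (auto simp: Suc_le_eq)
  qed auto
  with sum_moebius_mu_divisors[OF assms(1)] show ?thesis by simp
qed

text \<open>Passing from \<open>m\<close> to \<open>Suc m\<close> raises the quotient by one exactly
  when \<open>d\<close> divides \<open>Suc m\<close>; three such steps telescope.\<close>

lemma div_diff_3_eq_count:
  fixes n d :: nat
  assumes "n \<ge> 3"
  shows "n div d - (n - 3) div d
    = of_bool (d dvd n - 2) + of_bool (d dvd n - 1) + of_bool (d dvd n)"
proof -
  have step: "Suc m div d = m div d + of_bool (d dvd Suc m)" for m
    by (simp add: div_Suc dvd_eq_mod_eq_0)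
  have "Suc (n - 3) = n - 2" "Suc (n - 2) = n - 1" "Suc (n - 1) = n" using assms by auto
  with step[of "n - 3"] step[of "n - 2"] step[of "n - 1"]
  have "(n - 2) div d = (n - 3) div d + of_bool (d dvd n - 2)"
    "(n - 1) div d = (n - 2) div d + of_bool (d dvd n - 1)"
    "n div d = (n - 1) div d + of_bool (d dvd n)"
    by (simp_all only:)
  then show ?thesis by linarith
qed

lemma not_both_dvd_nearby:
  fixes a b d :: nat
  assumes "a < b" "b < a + d"
  shows "\<not> (d dvd a \<and> d dvd b)"
proof
  assume "d dvd a \<and> d dvd b"
  then have "d dvd b - a" by (simp add: dvd_diff_nat)
  then have "d \<le> b - a" using assms(1) by (intro dvd_imp_le) auto
  with assms show False by linarith
qed

lemma two_power_count_multiples: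
  fixes n d :: nat
  assumes "n > 3" "d > 0"
  shows "(2::int) ^ (n div d - (n - 3) div d)
    = 1 + of_bool (d dvd n - 2) + of_bool (d dvd n - 1) + of_bool (d dvd n)
      + (if d = 1 then 4 else 0) + (if d = 2 \<and> even n then 1 else 0)"
proof -
  have cnt: "n div d - (n - 3) div d
      = of_bool (d dvd n - 2) + of_bool (d dvd n - 1) + of_bool (d dvd n)"
    using assms by (intro div_diff_3_eq_count) auto
  consider "d = 1" | "d = 2" | "d \<ge> 3" using assms(2) by linarith
  then show ?thesis
  proof cases
    case 1
    \<comment> \<open>All three indicators are 1, and 8 = 1 + 3 + 4.\<close>
    then show ?thesis unfolding cnt by simp
  next
    case 2
    \<comment> \<open>For even \<open>n\<close> two indicators are 1, and 4 = 1 + 2 + 1; for odd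
      \<open>n\<close> only one is, and 2 = 1 + 1.\<close>
    have "even (n - 2) \<longleftrightarrow> even n" "even (n - 1) \<longleftrightarrow> odd n" using assms(1) by simp_all
    with 2 show ?thesis unfolding cnt by (cases "even n") simp_all
  next
    case 3
    \<comment> \<open>The three numbers lie within distance 2 < \<open>d\<close>, so at most one is
      a multiple of \<open>d\<close> and the exponent is 0 or 1.\<close>
    have pow: "(2::int) ^ (of_bool P + of_bool Q + of_bool R) = 1 + of_bool P + of_bool Q + of_bool R"
      if "\<not> (P \<and> Q)" "\<not> (P \<and> R)" "\<not> (Q \<and> R)" for P Q R
      using that by (cases P; cases Q; cases R) simp_all
    have "\<not> (d dvd n - 2 \<and> d dvd n - 1)" "\<not> (d dvd n - 2 \<and> d dvd n)"
      "\<not> (d dvd n - 1 \<and> d dvd n)"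
      using assms(1) 3 by (intro not_both_dvd_nearby; linarith)+
    from pow[OF this] 3 show ?thesis unfolding cnt by simp
  qed
qed

theorem theorem5:
  fixes n :: nat
  assumes "n > 3"
  shows "(\<Sum>d=1..n. moebius_mu d * 2 ^ (n div d - (n - 3) div d)) =
         (if even n then 3 + mertens n else 4 + mertens n)"
proof -
  have mu: "moebius_mu 1 = 1" "moebius_mu 2 = -1"
    by (simp_all add: moebius_mu_def squarefree_prime prime_prime_factors)
  have "(\<Sum>d=1..n. moebius_mu d * 2 ^ (n div d - (n - 3) div d))
      = (\<Sum>d=1..n. moebius_mu d + moebius_mu d * of_bool (d dvd n - 2)
          + moebius_mu d * of_bool (d dvd n - 1) + moebius_mu d * of_bool (d dvd n)
          + (if d = 1 then moebius_mu d * 4 else 0)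
          + (if d = 2 then moebius_mu d * of_bool (even n) else 0))"
    using assms by (intro sum.cong) (auto simp: two_power_count_multiples algebra_simps)
  \<comment> \<open>Each \<open>if\<close> collapses to a single term, as 1 and 2 lie in the range.
    The bound \<open>n > 3\<close> gives \<open>n - 2 > 1\<close>, so all three divisor sums
    vanish.\<close>
  also have "\<dots> = mertens n + 4 - of_bool (even n)"
    using assms mu sum_moebius_mu_dvd_indicator[of "n - 2" n]
      sum_moebius_mu_dvd_indicator[of "n - 1" n] sum_moebius_mu_dvd_indicator[of n n]
    by (simp add: sum.distrib mertens_def)
  finally show ?thesis by simp
qed

end
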